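(* Let $G=C_{n,n}$ be the crown graph with $n\ge 3$ and let $X=\{1,3,\ldots,2n-1\}$. Let $A\subset X$ with $|A|=n-2$ and let $T=A\cup\{i+1 : i\in A\}$. Then $\mathrm{v}_{P_T(G)}(J_G)=4$.
   Context: The crown graph $C_{n,n}$ is the bipartite graph with vertex set $\{1,\ldots,2n\}$, parts $X=\{2i-1 : 1\le i\le n\}$ and $Y=\{2i : 1\le i\le n\}$, and edges $\{2i-1,2j\}$ for all $i,j\in\{1,\ldots,n\}$ with $i\ne j$. Here $\mathbb{K}$ is an arbitrary field, $S=\mathbb{K}[x_1,\ldots,x_{2n},y_1,\ldots,y_{2n}]$ (standard graded, with degree-$d$ component $S_d$), and $J_G=\langle x_iy_j-x_jy_i : \{i,j\}\in E(G)\rangle$ is the binomial edge ideal. For $T\subseteq V(G)$, let $G_1,\ldots,G_c$ be the connected components of the induced subgraph of $G$ on $V(G)\setminus T$, let $\tilde G_i$ be the complete graph on $V(G_i)$, and set $P_T(G)=\langle x_i,y_i : i\in T\rangle+J_{\tilde G_1}+\cdots+J_{\tilde G_c}$. For the sets $T$ in the statement, $P_T(G)$ is a minimal prime (hence an associated prime) of $J_G$. For a proper nonzero homogeneous ideal $I\subseteq S$ and $\mathfrak{p}\in\mathrm{Ass}(I)$, the local $\mathrm{v}$-number is $\mathrm{v}_{\mathfrak{p}}(I)=\min\{d : \exists f\in S_d \text{ with } I:f=\mathfrak{p}\}$. *)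

theory Defs
  imports "HOL-Library.Poly_Mapping" "HOL-Library.Extended_Nat" "HOL-Algebra.Ideal"
begin

section \<open>The polynomial ring in the variables $x_1,\dots,x_N,y_1,\dots,y_N$\<close>

datatype indet = X nat | Y nat

type_synonym mono = "indet \<Rightarrow>\<^sub>0 nat"
type_synonym 'k xypoly = "mono \<Rightarrow>\<^sub>0 'k"

definition indets :: "nat \<Rightarrow> indet set" where
  "indets N = X ` {1..N} \<union> Y ` {1..N}"

text \<open>
  The type \<open>'k xypoly\<close> is the polynomial ring in infinitely many variables; the carrier
  cuts out the polynomials in the $2N$ variables above, so that ideals are ideals of this
  subring.
\<close>

definition xy_ring :: "nat \<Rightarrow> 'k::field xypoly ring" where
  "xy_ring N =
     \<lparr>carrier = {p. \<forall>m \<in> Poly_Mapping.keys p. Poly_Mapping.keys m \<subseteq> indets N},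
      mult = (*), one = 1, zero = 0, add = (+)\<rparr>"

definition xvar :: "nat \<Rightarrow> 'k::field xypoly" where
  "xvar i = Poly_Mapping.single (Poly_Mapping.single (X i) 1) 1"

definition yvar :: "nat \<Rightarrow> 'k::field xypoly" where
  "yvar i = Poly_Mapping.single (Poly_Mapping.single (Y i) 1) 1"

definition mono_degree :: "mono \<Rightarrow> nat" where
  "mono_degree m = (\<Sum>v \<in> Poly_Mapping.keys m. Poly_Mapping.lookup m v)"

definition hom_component :: "'k::field xypoly ring \<Rightarrow> nat \<Rightarrow> 'k xypoly set" where
  "hom_component S d =
     {f \<in> carrier S. \<forall>m \<in> Poly_Mapping.keys f. mono_degree m = d}"

lemma cring_xy_ring: "cring (xy_ring N :: 'k::field xypoly ring)"
proof -
  let ?C = "{p :: 'k xypoly. \<forall>m \<in> Poly_Mapping.keys p. Poly_Mapping.keys m \<subseteq> indets N}"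
  have add: "p + q \<in> ?C" if "p \<in> ?C" "q \<in> ?C" for p q
    using that keys_add[of p q] by blast
  have uminus: "- p \<in> ?C" if "p \<in> ?C" for p
    using that by (simp add: in_keys_iff)
  have mult: "p * q \<in> ?C" if "p \<in> ?C" "q \<in> ?C" for p q
  proof (rule CollectI, rule ballI)
    fix m assume "m \<in> Poly_Mapping.keys (p * q)"
    then obtain a b where "m = a + b" "a \<in> Poly_Mapping.keys p" "b \<in> Poly_Mapping.keys q"
      using keys_mult[of p q] by blast
    then show "Poly_Mapping.keys m \<subseteq> indets N"
      using that keys_add[of a b] by blast
  qed
  have inv: "\<exists>y \<in> ?C. y + x = 0" if "x \<in> ?C" for x
    using uminus[OF that] by (intro bexI[of _ "- x"]) simp_all
  have car: "carrier (xy_ring N) = ?C"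
    by (simp add: xy_ring_def)
  have ops: "x \<oplus>\<^bsub>xy_ring N\<^esub> y = x + y" "x \<otimes>\<^bsub>xy_ring N\<^esub> y = x * y"
    "\<zero>\<^bsub>xy_ring N\<^esub> = 0" "\<one>\<^bsub>xy_ring N\<^esub> = 1" for x y :: "'k xypoly"
    by (simp_all add: xy_ring_def)
  have zero_one: "0 \<in> ?C" "1 \<in> ?C"
    by simp_all
  show ?thesis
  proof (rule cringI)
    show "abelian_group (xy_ring N :: 'k xypoly ring)"
      by (rule abelian_groupI; unfold car ops)
         (erule (1) add | rule zero_one | erule inv | rule add.assoc | rule add_0_left | rule add.commute)+
    show "Group.comm_monoid (xy_ring N :: 'k xypoly ring)"
      by (rule comm_monoidI; unfold car ops)
         (erule (1) mult | rule zero_one | rule mult.assoc | rule mult_1_left | rule mult.commute)+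
  qed (simp add: ops distrib_right)
qed

lemma xvar_in_xy_ring: "i \<in> {1..N} \<Longrightarrow> xvar i \<in> carrier (xy_ring N)"
  by (simp add: xy_ring_def xvar_def indets_def)

lemma yvar_in_xy_ring: "i \<in> {1..N} \<Longrightarrow> yvar i \<in> carrier (xy_ring N)"
  by (simp add: xy_ring_def yvar_def indets_def)


section \<open>Finite simple graphs\<close>

text \<open>A graph is given by its vertex set and its set of edges, each an unordered pair.\<close>

type_synonym graph = "nat set \<times> nat set set"

abbreviation verts :: "graph \<Rightarrow> nat set" where "verts \<equiv> fst"
abbreviation edges :: "graph \<Rightarrow> nat set set" where "edges \<equiv> snd"

definition crown_graph :: "nat \<Rightarrow> graph" where
  "crown_graph n =
     ({1..2*n}, {{2*i - 1, 2*j} | i j. i \<in> {1..n} \<and> j \<in> {1..n} \<and> i \<noteq> j})"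

definition complete_graph :: "nat set \<Rightarrow> graph" where
  "complete_graph W = (W, {{i, j} | i j. i \<in> W \<and> j \<in> W \<and> i \<noteq> j})"

definition induced_subgraph :: "graph \<Rightarrow> nat set \<Rightarrow> graph" where
  "induced_subgraph G W = (verts G \<inter> W, {e \<in> edges G. e \<subseteq> W})"

definition connected_components :: "graph \<Rightarrow> nat set set" where
  "connected_components G =
     verts G // {(u, v). u \<in> verts G \<and> v \<in> verts G \<and> (u, v) \<in> {(a, b). {a, b} \<in> edges G}\<^sup>*}"


section \<open>Binomial edge ideals and the ideals $P_T(G)$\<close>

definition binomial_edge_ideal :: "'k::field xypoly ring \<Rightarrow> graph \<Rightarrow> 'k xypoly set" where
  "binomial_edge_ideal S G =
     Idl\<^bsub>S\<^esub> {xvar i * yvar j - xvar j * yvar i | i j. {i, j} \<in> edges G}"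

text \<open>A finite sum of ideals is the ideal generated by their union.\<close>

definition P_ideal :: "'k::field xypoly ring \<Rightarrow> graph \<Rightarrow> nat set \<Rightarrow> 'k xypoly set" where
  "P_ideal S G T =
     Idl\<^bsub>S\<^esub> (Idl\<^bsub>S\<^esub> (xvar ` T \<union> yvar ` T) \<union>
       (\<Union>W \<in> connected_components (induced_subgraph G (verts G - T)).
          binomial_edge_ideal S (complete_graph W)))"


section \<open>Local v-numbers\<close>

definition colon_ideal :: "('a, 'b) ring_scheme \<Rightarrow> 'a set \<Rightarrow> 'a \<Rightarrow> 'a set" where
  "colon_ideal R I f = {g \<in> carrier R. g \<otimes>\<^bsub>R\<^esub> f \<in> I}"

text \<open>
  The infimum over a nonempty set of extended naturals is its minimum; over the empty set,
  i.e.\ when no homogeneous \<open>f\<close> has \<open>I : f = P\<close>, it is \<open>\<infinity>\<close>.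
\<close>

definition local_v_number ::
  "'k::field xypoly ring \<Rightarrow> 'k xypoly set \<Rightarrow> 'k xypoly set \<Rightarrow> enat" where
  "local_v_number S P I =
     Inf (enat ` {d. \<exists>f \<in> hom_component S d. colon_ideal S I f = P})"

end

theory Submission
  imports Defs
begin

text \<open>
  Deleting \<open>T\<close> leaves four vertices: two odd ones \<open>a\<close>, \<open>b\<close> and their twins \<open>a + 1\<close>, \<open>b + 1\<close>.
  They span the two disjoint edges \<open>{a, b + 1}\<close> and \<open>{b, a + 1}\<close>. Write \<open>J\<close> for the
  edge ideal and \<open>[i, j] = x\<^sub>i y\<^sub>j - x\<^sub>j y\<^sub>i\<close>. Three observations prove the theorem.

  First, \<open>P\<^sub>T\<close> is the kernel of an explicit substitution \<open>\<Phi>\<close> (\<open>prime_param\<close>) with values in an integral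
  domain: deleted vertices go to \<open>0\<close>, and a surviving vertex \<open>v\<close> goes to
  \<open>(X\<^sub>v, X\<^sub>v Y\<^sub>C)\<close>, where \<open>C\<close> is the component of \<open>v\<close>; so the two ends of
  a surviving edge become parallel vectors (\<open>P_ideal_eq_kernel\<close>). In particular \<open>P\<^sub>T\<close> is prime.

  Second, \<open>h = [a, b] [a + 1, b + 1]\<close> satisfies \<open>h P\<^sub>T \<subseteq> J\<close> and \<open>\<Phi>(h) \<noteq> 0\<close>.
  Indeed every deleted vertex is adjacent to both \<open>a\<close> and \<open>b\<close> or to both \<open>a + 1\<close> and
  \<open>b + 1\<close>, and a Pluecker relation then pushes the corresponding factor of \<open>h\<close> into \<open>J\<close>.
  As \<open>J \<subseteq> P\<^sub>T\<close> and \<open>P\<^sub>T\<close> is prime, \<open>J : h = P\<^sub>T\<close>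
  (\<open>colon_witness\<close>), so degree \<open>4\<close> is attained.

  Third, let \<open>J : f = P\<^sub>T\<close> with \<open>f\<close> homogeneous of degree \<open>d\<close>. Then \<open>\<Phi>(f) \<noteq> 0\<close>,
  for otherwise \<open>f \<in> P\<^sub>T\<close>, hence \<open>h f \<in> J\<close> and \<open>h \<in> P\<^sub>T\<close>. For each surviving vertex
  \<open>r\<close> there is a second substitution \<open>\<Psi>\<^sub>r\<close> (\<open>degenerate_param\<close>) that kills \<open>J\<close>, agrees with
  \<open>\<Phi>\<close> modulo \<open>X\<^sub>r\<close>, and does not kill some deleted variable \<open>x\<^sub>v\<close>. Since
  \<open>x\<^sub>v f \<in> J\<close>, it follows that \<open>\<Psi>\<^sub>r(f) = 0\<close>, so \<open>X\<^sub>r\<close> divides \<open>\<Phi>(f)\<close>. Thus every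
  monomial of \<open>\<Phi>(f)\<close> involves all four of the variables \<open>X\<^sub>r\<close>; but its degree in
  these variables is \<open>d\<close>, hence \<open>d \<ge> 4\<close> (\<open>degree_ge_4_if_colon_eq_kernel\<close>). Geometrically,
  \<open>\<Psi>\<^sub>r\<close> with \<open>r\<close> odd parametrizes part of the component of the variety of \<open>J\<close> obtained by
  deleting all odd vertices except the surviving one other than \<open>r\<close>; the case of even \<open>r\<close>
  is symmetric.
\<close>

section \<open>The polynomial ring as an integral domain\<close>

text \<open>
  A linear order on the indeterminates makes the exponent vectors a linearly ordered
  cancellative monoid, from which it follows that the polynomial ring has no zero divisors.
\<close>

instantiation indet :: linorder
begin

fun indet_code :: "indet \<Rightarrow> nat" where
  "indet_code (X i) = 2 * i"
| "indet_code (Y i) = 2 * i + 1"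

definition less_eq_indet :: "indet \<Rightarrow> indet \<Rightarrow> bool" where
  "u \<le> v \<longleftrightarrow> indet_code u \<le> indet_code v"

definition less_indet :: "indet \<Rightarrow> indet \<Rightarrow> bool" where
  "u < v \<longleftrightarrow> indet_code u < indet_code v"

instance
proof
  fix u v :: indet
  assume "u \<le> v" "v \<le> u"
  then have "indet_code u = indet_code v"
    by (simp add: less_eq_indet_def)
  then show "u = v"
    by (cases u; cases v) (simp_all, presburger+)
qed (auto simp: less_eq_indet_def less_indet_def)

end

lemma sum_single_lookup:
  fixes f :: "'a \<Rightarrow>\<^sub>0 'b::comm_monoid_add"
  shows "(\<Sum>m\<in>Poly_Mapping.keys f. Poly_Mapping.single m (Poly_Mapping.lookup f m)) = f"
  by (rule poly_mapping_eqI) (simp add: lookup_sum lookup_single when_def sum.delta in_keys_iff)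

lemma poly_mapping_add_induct:
  fixes f :: "'a \<Rightarrow>\<^sub>0 'b::comm_monoid_add"
  assumes "P 0" "\<And>m c. P (Poly_Mapping.single m c)" "\<And>f g. P f \<Longrightarrow> P g \<Longrightarrow> P (f + g)"
  shows "P f"
proof -
  have "P (\<Sum>m\<in>K. Poly_Mapping.single m (Poly_Mapping.lookup f m))" if "finite K" for K
    using that by (induction K rule: finite_induct) (auto intro: assms)
  from this[OF finite_keys] show ?thesis
    by (metis sum_single_lookup)
qed

section \<open>Substitution homomorphisms\<close>

definition mono_val :: "(indet \<Rightarrow> 'k::field xypoly) \<Rightarrow> mono \<Rightarrow> 'k xypoly" where
  "mono_val \<phi> m = (\<Prod>v\<in>Poly_Mapping.keys m. \<phi> v ^ Poly_Mapping.lookup m v)"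

definition subst :: "(indet \<Rightarrow> 'k::field xypoly) \<Rightarrow> 'k xypoly \<Rightarrow> 'k xypoly" where
  "subst \<phi> f = (\<Sum>m\<in>Poly_Mapping.keys f.
     Poly_Mapping.single 0 (Poly_Mapping.lookup f m) * mono_val \<phi> m)"

lemma mono_val_eq_prod:
  assumes "finite V" "Poly_Mapping.keys m \<subseteq> V"
  shows "mono_val \<phi> m = (\<Prod>v\<in>V. \<phi> v ^ Poly_Mapping.lookup m v)"
  unfolding mono_val_def
  by (rule prod.mono_neutral_left) (use assms in \<open>auto simp: in_keys_iff\<close>)

lemma mono_val_add: "mono_val \<phi> (m + n) = mono_val \<phi> m * mono_val \<phi> n"
proof -
  let ?V = "Poly_Mapping.keys m \<union> Poly_Mapping.keys n"
  have "mono_val \<phi> k = (\<Prod>v\<in>?V. \<phi> v ^ Poly_Mapping.lookup k v)" if "k \<in> {m, n, m + n}" for k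
    by (rule mono_val_eq_prod) (use that keys_add[of m n] in auto)
  then show ?thesis
    by (simp add: lookup_add power_add prod.distrib)
qed

lemma subst_eq_sum:
  assumes "finite M" "Poly_Mapping.keys f \<subseteq> M"
  shows "subst \<phi> f = (\<Sum>m\<in>M. Poly_Mapping.single 0 (Poly_Mapping.lookup f m) * mono_val \<phi> m)"
  unfolding subst_def
  by (rule sum.mono_neutral_left) (use assms in \<open>auto simp: in_keys_iff\<close>)

lemma subst_zero [simp]: "subst \<phi> 0 = 0"
  by (simp add: subst_def)

lemma subst_single: "subst \<phi> (Poly_Mapping.single m c) = Poly_Mapping.single 0 c * mono_val \<phi> m"
  by (simp add: subst_def)

lemma subst_add: "subst \<phi> (f + g) = subst \<phi> f + subst \<phi> g"
proof -
  let ?M = "Poly_Mapping.keys f \<union> Poly_Mapping.keys g"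
  have "subst \<phi> k = (\<Sum>m\<in>?M. Poly_Mapping.single 0 (Poly_Mapping.lookup k m) * mono_val \<phi> m)"
    if "k \<in> {f, g, f + g}" for k
    by (rule subst_eq_sum) (use that keys_add[of f g] in auto)
  then show ?thesis
    by (simp add: lookup_add single_add distrib_right sum.distrib)
qed

lemma subst_diff: "subst \<phi> (f - g) = subst \<phi> f - subst \<phi> g"
  using subst_add[of \<phi> "f - g" g] by simp

lemma subst_mult: "subst \<phi> (f * g) = subst \<phi> f * subst \<phi> g"
proof (induction f rule: poly_mapping_add_induct)
  case (2 m c)
  show ?case
  proof (induction g rule: poly_mapping_add_induct)
    case (2 n d)
    have "Poly_Mapping.single (0 :: mono) (c * d) = Poly_Mapping.single 0 c * Poly_Mapping.single 0 d"
      by (simp add: mult_single)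
    then show ?case
      unfolding mult_single[of m] subst_single mono_val_add by (simp only: mult_ac)
  qed (simp_all add: subst_add distrib_left)
qed (simp_all add: subst_add distrib_right)

lemma subst_xvar [simp]: "subst \<phi> (xvar i) = \<phi> (X i)"
  by (simp add: xvar_def subst_single mono_val_def)

lemma subst_yvar [simp]: "subst \<phi> (yvar i) = \<phi> (Y i)"
  by (simp add: yvar_def subst_single mono_val_def)

lemma dvd_mult_diff:
  fixes d :: "'a::comm_ring_1"
  assumes "d dvd x - y" "d dvd x' - y'"
  shows "d dvd x * x' - y * y'"
proof -
  have "x * x' - y * y' = (x - y) * x' + y * (x' - y')"
    by (simp add: algebra_simps)
  then show ?thesis
    using assms by (metis dvd_add dvd_mult dvd_mult2)
qed

lemma dvd_power_diff:
  fixes d :: "'a::comm_ring_1"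
  assumes "d dvd x - y"
  shows "d dvd x ^ k - y ^ k"
  by (induction k) (simp_all add: dvd_mult_diff assms)

text \<open>
  Substitutions that agree modulo \<open>d\<close> on the variables agree modulo \<open>d\<close> everywhere. This
  transports information between two substitutions without an explicit quotient ring.
\<close>

lemma dvd_subst_diff:
  assumes "\<And>v. d dvd \<phi> v - \<psi> v"
  shows "d dvd subst \<phi> f - subst \<psi> f"
proof (induction f rule: poly_mapping_add_induct)
  case (2 m c)
  have "d dvd (\<Prod>v\<in>V. \<phi> v ^ k v) - (\<Prod>v\<in>V. \<psi> v ^ k v)" if "finite V" for V and k :: "indet \<Rightarrow> nat"
    using that by (induction V rule: finite_induct) (simp_all add: dvd_mult_diff dvd_power_diff assms)
  then have "d dvd mono_val \<phi> m - mono_val \<psi> m"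
    by (simp add: mono_val_def)
  then show ?case
    by (simp add: subst_single dvd_mult flip: right_diff_distrib)
next
  case (3 f g)
  from dvd_add[OF this] show ?case
    by (simp add: subst_add algebra_simps)
qed simp

section \<open>Weighted homogeneous polynomials\<close>

text \<open>
  The lower bound counts only part of the variables of the target of a substitution, so
  homogeneity is needed for gradings other than the total degree.
\<close>

definition weighted_hom :: "(mono \<Rightarrow> nat) \<Rightarrow> nat \<Rightarrow> 'k::field xypoly \<Rightarrow> bool" where
  "weighted_hom w d f \<longleftrightarrow> (\<forall>m \<in> Poly_Mapping.keys f. w m = d)"

definition weight :: "(mono \<Rightarrow> nat) \<Rightarrow> bool" where
  "weight w \<longleftrightarrow> w 0 = 0 \<and> (\<forall>m n. w (m + n) = w m + w n)"

lemma weighted_hom_mult: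
  assumes "weight w" "weighted_hom w d f" "weighted_hom w e g"
  shows "weighted_hom w (d + e) (f * g)"
  using assms keys_mult[of f g] by (fastforce simp: weighted_hom_def weight_def)

lemma weighted_hom_power:
  assumes "weight w" "weighted_hom w d f"
  shows "weighted_hom w (k * d) (f ^ k)"
proof (induction k)
  case 0
  then show ?case
    using assms(1) by (simp add: weighted_hom_def weight_def)
next
  case (Suc k)
  then show ?case
    using weighted_hom_mult[OF assms(1,2) Suc] by simp
qed

lemma weighted_hom_diff:
  assumes "weighted_hom w d f" "weighted_hom w d g"
  shows "weighted_hom w d (f - g)"
  using assms keys_diff[of f g] by (auto simp: weighted_hom_def)

lemma weighted_hom_sum:
  assumes "\<And>i. i \<in> I \<Longrightarrow> weighted_hom w d (f i)"
  shows "weighted_hom w d (sum f I)"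
  using assms keys_sum[of f I] by (auto simp: weighted_hom_def)

lemma weight_mono_degree: "weight mono_degree"
  unfolding weight_def
proof (intro conjI allI)
  fix m n :: mono
  let ?V = "Poly_Mapping.keys m \<union> Poly_Mapping.keys n"
  have "mono_degree k = (\<Sum>v\<in>?V. Poly_Mapping.lookup k v)" if "k \<in> {m, n, m + n}" for k
    unfolding mono_degree_def
    by (rule sum.mono_neutral_left) (use that keys_add[of m n] in \<open>auto simp: in_keys_iff\<close>)
  then show "mono_degree (m + n) = mono_degree m + mono_degree n"
    by (simp add: lookup_add sum.distrib)
qed (simp add: mono_degree_def)

lemma weighted_hom_xvar: "weighted_hom mono_degree 1 (xvar i :: 'k::field xypoly)"
  and weighted_hom_yvar: "weighted_hom mono_degree 1 (yvar i :: 'k::field xypoly)"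
  by (simp_all add: weighted_hom_def xvar_def yvar_def mono_degree_def)

lemma weighted_hom_subst:
  assumes w: "weight w" and \<phi>: "\<And>v. weighted_hom w 1 (\<phi> v)"
    and f: "weighted_hom mono_degree d f"
  shows "weighted_hom w d (subst \<phi> f)"
  unfolding subst_def
proof (rule weighted_hom_sum)
  fix m assume "m \<in> Poly_Mapping.keys f"
  then have d: "d = mono_degree m"
    using f by (simp add: weighted_hom_def)
  have prod: "weighted_hom w (\<Sum>v\<in>V. k v) (\<Prod>v\<in>V. \<phi> v ^ k v)"
    if "finite V" for V and k :: "indet \<Rightarrow> nat"
    using that
  proof (induction V rule: finite_induct)
    case empty
    then show ?case
      using w by (simp add: weighted_hom_def weight_def)
  next
    case (insert v V)
    then show ?case
      using weighted_hom_mult[OF w weighted_hom_power[OF w \<phi>[of v], of "k v"]] by simp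
  qed
  have "weighted_hom w 0 (Poly_Mapping.single 0 c)" for c :: 'a
    using w by (simp add: weighted_hom_def weight_def)
  from weighted_hom_mult[OF w this prod[OF finite_keys]]
  show "weighted_hom w d (Poly_Mapping.single 0 (Poly_Mapping.lookup f m) * mono_val \<phi> m)"
    by (simp add: mono_val_def d mono_degree_def)
qed

lemma lookup_ge_1_of_xvar_dvd:
  assumes "xvar r dvd f" "e \<in> Poly_Mapping.keys f"
  shows "1 \<le> Poly_Mapping.lookup e (X r)"
proof -
  obtain g where "f = xvar r * g"
    using assms(1) by (auto elim: dvdE)
  then obtain e' where "e = Poly_Mapping.single (X r) 1 + e'"
    using assms(2) keys_mult[of "xvar r" g] by (fastforce simp: xvar_def)
  then show ?thesis
    by (simp add: lookup_add)
qed

section \<open>Ideals of the polynomial ring\<close>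

abbreviation poly_carrier :: "nat \<Rightarrow> 'k::field xypoly set" where
  "poly_carrier N \<equiv> carrier (xy_ring N)"

lemma xy_ring_ops [simp]:
  "p \<oplus>\<^bsub>xy_ring N\<^esub> q = p + q" "p \<otimes>\<^bsub>xy_ring N\<^esub> q = p * q"
  "\<zero>\<^bsub>xy_ring N\<^esub> = 0" "\<one>\<^bsub>xy_ring N\<^esub> = 1"
  by (simp_all add: xy_ring_def)

lemma ring_xy_ring: "ring (xy_ring N)"
  using cring_xy_ring cring.axioms(1) by blast

lemma poly_carrier_closed:
  fixes p q :: "'k::field xypoly"
  shows "0 \<in> (poly_carrier N :: 'k xypoly set)" "1 \<in> (poly_carrier N :: 'k xypoly set)"
    "p \<in> poly_carrier N \<Longrightarrow> q \<in> poly_carrier N \<Longrightarrow> p + q \<in> poly_carrier N"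
    "p \<in> poly_carrier N \<Longrightarrow> q \<in> poly_carrier N \<Longrightarrow> p * q \<in> poly_carrier N"
    "p \<in> poly_carrier N \<Longrightarrow> q \<in> poly_carrier N \<Longrightarrow> p - q \<in> poly_carrier N"
    "p \<in> poly_carrier N \<Longrightarrow> - p \<in> poly_carrier N"
    "p \<in> poly_carrier N \<Longrightarrow> p ^ k \<in> poly_carrier N"
proof -
  interpret ring "xy_ring N :: 'k xypoly ring" by (rule ring_xy_ring)
  show z: "0 \<in> (poly_carrier N :: 'k xypoly set)" "1 \<in> (poly_carrier N :: 'k xypoly set)"
    by (simp_all add: xy_ring_def)
  show a: "p \<in> poly_carrier N \<Longrightarrow> q \<in> poly_carrier N \<Longrightarrow> p + q \<in> poly_carrier N" for p q :: "'k xypoly"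
    using a_closed by simp
  show m: "p \<in> poly_carrier N \<Longrightarrow> q \<in> poly_carrier N \<Longrightarrow> p * q \<in> poly_carrier N" for p q :: "'k xypoly"
    using m_closed by simp
  show u: "p \<in> poly_carrier N \<Longrightarrow> - p \<in> poly_carrier N" for p :: "'k xypoly"
    by (simp add: xy_ring_def)
  show "p \<in> poly_carrier N \<Longrightarrow> q \<in> poly_carrier N \<Longrightarrow> p - q \<in> poly_carrier N"
    using a[OF _ u, of p q] by simp
  show "p \<in> poly_carrier N \<Longrightarrow> p ^ k \<in> poly_carrier N"
    by (induction k) (simp_all add: z m)
qed

lemma ideal_closed:
  assumes "ideal I (xy_ring N)"
  shows "I \<subseteq> poly_carrier N" "0 \<in> I" "p \<in> I \<Longrightarrow> q \<in> I \<Longrightarrow> p + q \<in> I"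
    "s \<in> poly_carrier N \<Longrightarrow> p \<in> I \<Longrightarrow> s * p \<in> I"
    "p \<in> I \<Longrightarrow> q \<in> I \<Longrightarrow> p - q \<in> I"
proof -
  interpret ideal I "xy_ring N" by (rule assms)
  show "I \<subseteq> poly_carrier N" by (rule a_subset)
  show "0 \<in> I" using additive_subgroup.zero_closed[OF is_additive_subgroup] by simp
  show a: "p \<in> I \<Longrightarrow> q \<in> I \<Longrightarrow> p + q \<in> I" for p q using additive_subgroup.a_closed[OF is_additive_subgroup, of p q] by simp
  show m: "s \<in> poly_carrier N \<Longrightarrow> p \<in> I \<Longrightarrow> s * p \<in> I" for s p using I_l_closed[of p s] by simp
  show "p - q \<in> I" if "p \<in> I" "q \<in> I"
    using a[OF that(1) m[OF poly_carrier_closed(6)[OF poly_carrier_closed(2)] that(2)]] by simp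
qed

lemma ideal_xy_ringI:
  fixes I :: "'k::field xypoly set"
  assumes "I \<subseteq> poly_carrier N" "0 \<in> I" "\<And>p q. p \<in> I \<Longrightarrow> q \<in> I \<Longrightarrow> p + q \<in> I"
    "\<And>s p. s \<in> poly_carrier N \<Longrightarrow> p \<in> I \<Longrightarrow> s * p \<in> I"
  shows "ideal I (xy_ring N)"
proof -
  interpret ring "xy_ring N :: 'k xypoly ring" by (rule ring_xy_ring)
  have minus: "\<ominus>\<^bsub>xy_ring N\<^esub> p \<in> I" if "p \<in> I" for p
  proof -
    have "\<ominus>\<^bsub>xy_ring N\<^esub> p = - 1 * p"
      by (rule minus_equality) (use that assms(1) in \<open>auto simp: poly_carrier_closed\<close>)
    then show ?thesis
      using assms(4)[of "-1" p] that by (simp add: poly_carrier_closed)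
  qed
  show ?thesis
  proof (rule idealI[OF ring_xy_ring])
    show "subgroup I (add_monoid (xy_ring N))"
      by (rule subgroup.intro) (use assms minus in \<open>auto simp: a_inv_def\<close>)
  next
    show "p \<otimes>\<^bsub>xy_ring N\<^esub> s \<in> I" "s \<otimes>\<^bsub>xy_ring N\<^esub> p \<in> I" if "p \<in> I" "s \<in> poly_carrier N" for p s
      using assms(4)[OF that(2,1)] by (simp_all add: mult.commute)
  qed
qed

lemma ideal_kernel_subst: "ideal {g \<in> poly_carrier N. subst \<phi> g = 0} (xy_ring N)"
  by (rule ideal_xy_ringI) (auto simp: poly_carrier_closed subst_add subst_mult)

lemma ideal_colon:
  assumes "ideal I (xy_ring N)"
  shows "ideal (colon_ideal (xy_ring N) I h) (xy_ring N)"
  by (rule ideal_xy_ringI)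
    (auto simp: colon_ideal_def poly_carrier_closed ideal_closed[OF assms] distrib_right mult.assoc)

lemma ideal_mult_diff:
  assumes "ideal I (xy_ring N)" "p - q \<in> I" "p' - q' \<in> I" "p' \<in> poly_carrier N" "q \<in> poly_carrier N"
  shows "p * p' - q * q' \<in> I"
proof -
  have "p * p' - q * q' = p' * (p - q) + q * (p' - q')"
    by (simp add: algebra_simps)
  then show ?thesis
    using assms by (simp add: ideal_closed[OF assms(1)])
qed

lemma ideal_power_diff:
  assumes "ideal I (xy_ring N)" "p - q \<in> I" "p \<in> poly_carrier N" "q \<in> poly_carrier N"
  shows "p ^ s - q ^ s \<in> I"
  by (induction s)
    (simp_all add: ideal_closed[OF assms(1)] ideal_mult_diff[OF assms(1,2)] assms poly_carrier_closed)

text \<open>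
  Modulo the single relation \<open>x y' = x' y\<close> a monomial is determined by its degrees in
  \<open>{x, y}\<close> and \<open>{x', y'}\<close> and its total degree in \<open>{y, y'}\<close>: two monomials with the same such
  degrees differ by a power of the exchange \<open>x y' \<leftrightarrow> x' y\<close>.
\<close>

lemma monomial_exchange:
  assumes I: "ideal I (xy_ring N)" and f: "x * y' - x' * y \<in> I"
    and car: "x \<in> poly_carrier N" "y \<in> poly_carrier N" "x' \<in> poly_carrier N" "y' \<in> poly_carrier N"
    and eq: "i + j = i' + j'" "k + l = k' + l'" "j + l = j' + l'"
  shows "(x ^ i * y ^ j) * (x' ^ k * y' ^ l) - (x ^ i' * y ^ j') * (x' ^ k' * y' ^ l') \<in> I"
proof -
  have main: "(x ^ (i + s) * y ^ j) * (x' ^ k * y' ^ (l + s)) - (x ^ i * y ^ (j + s)) * (x' ^ (k + s) * y' ^ l) \<in> I"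
    for i j k l s
  proof -
    have "(x * y') ^ s - (x' * y) ^ s \<in> I"
      by (rule ideal_power_diff[OF I f]) (simp_all add: car poly_carrier_closed)
    then have "x ^ i * y ^ j * x' ^ k * y' ^ l * ((x * y') ^ s - (x' * y) ^ s) \<in> I"
      by (intro ideal_closed(4)[OF I]) (simp_all add: car poly_carrier_closed)
    then show ?thesis
      by (simp add: algebra_simps power_add power_mult_distrib)
  qed
  show ?thesis
  proof (cases "i' \<le> i")
    case True
    define s where "s = i - i'"
    have "i = i' + s" "j' = j + s" "l = l' + s" "k' = k + s"
      using True eq by (simp_all add: s_def)
    then show ?thesis
      using main[of i' s j k l'] by simp
  next
    case False
    define s where "s = i' - i"
    have "i' = i + s" "j = j' + s" "l' = l + s" "k = k' + s"
      using False eq by (simp_all add: s_def)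
    then show ?thesis
      using ideal_closed(5)[OF I ideal_closed(2)[OF I] main[of i s j' k' l]] by simp
  qed
qed

lemma genideal_xy_ring:
  assumes "A \<subseteq> poly_carrier N"
  shows "ideal (Idl\<^bsub>xy_ring N\<^esub> A) (xy_ring N)" "A \<subseteq> Idl\<^bsub>xy_ring N\<^esub> A"
    "ideal I (xy_ring N) \<Longrightarrow> A \<subseteq> I \<Longrightarrow> Idl\<^bsub>xy_ring N\<^esub> A \<subseteq> I"
  using ring.genideal_ideal[OF ring_xy_ring assms] ring.genideal_self[OF ring_xy_ring assms]
    ring.genideal_minimal[OF ring_xy_ring] by blast+

section \<open>Kernels of monomial substitutions\<close>

text \<open>
  A substitution that sends every monomial to a monomial or to \<open>0\<close> has a kernel spanned by the
  monomials sent to \<open>0\<close> and the differences of monomials with the same image. The proof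
  removes one monomial of \<open>g\<close> at a time: if its image is not \<open>0\<close>, that image has to cancel
  against the image of another monomial of \<open>g\<close>, onto which its coefficient can be moved.
\<close>

lemma kernel_subst_subset_if_fibres:
  fixes g :: "'k::field xypoly"
  assumes add: "\<And>p q. p \<in> I \<Longrightarrow> q \<in> I \<Longrightarrow> p + q \<in> I" and zero: "0 \<in> I"
    and bad: "\<And>m c. m \<in> M \<Longrightarrow> \<not> good m \<Longrightarrow> mono_val \<phi> m = 0 \<and> Poly_Mapping.single m c \<in> I"
    and good: "\<And>m. m \<in> M \<Longrightarrow> good m \<Longrightarrow> mono_val \<phi> m = Poly_Mapping.single (\<epsilon> m) 1"
    and fibre: "\<And>m m' c. m \<in> M \<Longrightarrow> m' \<in> M \<Longrightarrow> good m \<Longrightarrow> good m' \<Longrightarrow> \<epsilon> m = \<epsilon> m' \<Longrightarrow>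
      Poly_Mapping.single m c - Poly_Mapping.single m' c \<in> I"
    and g: "Poly_Mapping.keys g \<subseteq> M" "subst \<phi> g = 0"
  shows "g \<in> I"
  using g
proof (induction "card (Poly_Mapping.keys g)" arbitrary: g rule: less_induct)
  case less
  show ?case
  proof (cases "g = 0")
    case True
    then show ?thesis
      by (simp add: zero)
  next
    case False
    then obtain m where m: "m \<in> Poly_Mapping.keys g"
      by (metis ex_in_conv keys_eq_empty)
    define c where "c = Poly_Mapping.lookup g m"
    define g' where "g' = g - Poly_Mapping.single m c"
    have c: "c \<noteq> 0"
      using m by (simp add: c_def in_keys_iff)
    have keys': "Poly_Mapping.keys g' = Poly_Mapping.keys g - {m}"
      by (auto simp: g'_def c_def in_keys_iff lookup_minus lookup_single when_def split: if_splits)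
    have fewer: "f \<in> I" if "Poly_Mapping.keys f \<subseteq> Poly_Mapping.keys g'" "subst \<phi> f = 0" for f
      by (rule less.hyps[OF psubset_card_mono]) (use that keys' m less.prems in auto)
    have image: "subst \<phi> (Poly_Mapping.single k d) =
        (if good k then Poly_Mapping.single (\<epsilon> k) d else 0)" if "k \<in> M" for k d
      using that good[of k] bad[of k] by (simp add: subst_single mult_single)
    have mM: "m \<in> M"
      using m less.prems by auto
    show ?thesis
    proof (cases "good m")
      case False
      then have "g' \<in> I" "Poly_Mapping.single m c \<in> I"
        using fewer[of g'] less.prems image[OF mM] bad[OF mM] by (simp_all add: g'_def subst_diff)
      then show ?thesis
        using add[of g' "Poly_Mapping.single m c"] by (simp add: g'_def)
    next
      case True
      have "\<exists>k\<in>Poly_Mapping.keys g'. good k \<and> \<epsilon> k = \<epsilon> m"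
      proof (rule ccontr)
        assume no: "\<not> ?thesis"
        have "subst \<phi> g' = (\<Sum>k\<in>Poly_Mapping.keys g'. subst \<phi> (Poly_Mapping.single k (Poly_Mapping.lookup g' k)))"
          by (simp only: subst_def[of \<phi> g'] subst_single)
        moreover have "Poly_Mapping.lookup (subst \<phi> (Poly_Mapping.single k d)) (\<epsilon> m) = 0"
          if "k \<in> Poly_Mapping.keys g'" for k d
          using that no less.prems by (subst image) (auto simp: keys' lookup_single when_def)
        ultimately have "Poly_Mapping.lookup (subst \<phi> g') (\<epsilon> m) = 0"
          by (simp add: lookup_sum)
        moreover have "subst \<phi> g' = - Poly_Mapping.single (\<epsilon> m) c"
          using less.prems True by (simp add: g'_def subst_diff image[OF mM])
        ultimately show False
          using c by simp
      qed
      then obtain k where k: "k \<in> Poly_Mapping.keys g'" "good k" "\<epsilon> k = \<epsilon> m"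
        by auto
      have kM: "k \<in> M"
        using k keys' less.prems by auto
      have "g' + Poly_Mapping.single k c \<in> I"
      proof (rule fewer)
        show "Poly_Mapping.keys (g' + Poly_Mapping.single k c) \<subseteq> Poly_Mapping.keys g'"
          using keys_add[of g' "Poly_Mapping.single k c"] k(1) by (auto split: if_splits)
        show "subst \<phi> (g' + Poly_Mapping.single k c) = 0"
          using less.prems True k by (simp add: g'_def subst_diff subst_add image[OF mM] image[OF kM])
      qed
      from add[OF this fibre[OF mM kM True k(2) k(3)[symmetric], of c]] show ?thesis
        by (simp add: g'_def)
    qed
  qed
qed

lemma xvar_nonzero: "xvar i \<noteq> 0"
  by (simp add: xvar_def flip: keys_eq_empty)

lemma xvar_power: "xvar i ^ k = Poly_Mapping.single (Poly_Mapping.single (X i) k) 1"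
  and yvar_power: "yvar i ^ k = Poly_Mapping.single (Poly_Mapping.single (Y i) k) 1"
  by (induction k) (simp_all add: xvar_def yvar_def mult_single flip: single_add)

lemma prod_var_powers:
  "(\<Prod>v\<in>V. xvar (f v) ^ p v * yvar (g v) ^ q v) =
     (Poly_Mapping.single (\<Sum>v\<in>V. Poly_Mapping.single (X (f v)) (p v) + Poly_Mapping.single (Y (g v)) (q v)) 1
       :: 'k::field xypoly)"
  by (induction V rule: infinite_finite_induct)
    (simp_all add: xvar_power yvar_power mult_single)

lemma mono_val_over_vertices:
  assumes "finite V" "Poly_Mapping.keys m \<subseteq> X ` V \<union> Y ` V"
  shows "mono_val \<phi> m = (\<Prod>v\<in>V. \<phi> (X v) ^ Poly_Mapping.lookup m (X v) * \<phi> (Y v) ^ Poly_Mapping.lookup m (Y v))"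
proof -
  have "mono_val \<phi> m = (\<Prod>u\<in>X ` V \<union> Y ` V. \<phi> u ^ Poly_Mapping.lookup m u)"
    using assms by (intro mono_val_eq_prod) auto
  also have "\<dots> = (\<Prod>u\<in>X ` V. \<phi> u ^ Poly_Mapping.lookup m u) * (\<Prod>u\<in>Y ` V. \<phi> u ^ Poly_Mapping.lookup m u)"
    using assms by (intro prod.union_disjoint) auto
  finally show ?thesis
    by (simp add: prod.reindex inj_on_def prod.distrib)
qed

lemma single_over_vertices:
  fixes c :: "'k::field"
  assumes "finite V" "Poly_Mapping.keys m \<subseteq> X ` V \<union> Y ` V"
  shows "Poly_Mapping.single m c = Poly_Mapping.single 0 c *
    (\<Prod>v\<in>V. xvar v ^ Poly_Mapping.lookup m (X v) * yvar v ^ Poly_Mapping.lookup m (Y v))"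
proof -
  have "(\<Sum>v\<in>V. Poly_Mapping.single (X v) (Poly_Mapping.lookup m (X v)) +
      Poly_Mapping.single (Y v) (Poly_Mapping.lookup m (Y v))) = m"
    (is "?s = m")
  proof (rule poly_mapping_eqI)
    fix u
    show "Poly_Mapping.lookup ?s u = Poly_Mapping.lookup m u"
    proof (cases u)
      case (X i)
      then show ?thesis
        using assms by (auto simp: lookup_sum lookup_add lookup_single when_def sum.delta in_keys_iff)
    next
      case (Y i)
      then show ?thesis
        using assms by (auto simp: lookup_sum lookup_add lookup_single when_def sum.delta in_keys_iff)
    qed
  qed
  then show ?thesis
    using prod_var_powers[of "\<lambda>v. v" "\<lambda>v. Poly_Mapping.lookup m (X v)" "\<lambda>v. v" "\<lambda>v. Poly_Mapping.lookup m (Y v)" V,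
        where ?'k = 'k]
    by (simp add: mult_single)
qed

section \<open>Substitutions that annihilate binomial edge ideals\<close>

definition edge_binomial :: "nat \<Rightarrow> nat \<Rightarrow> 'k::field xypoly" where
  "edge_binomial i j = xvar i * yvar j - xvar j * yvar i"

text \<open>
  The vertex \<open>v\<close> is placed at the vector \<open>c v \<cdot> (1, \<tau> v)\<close> of the plane. The binomial of an edge
  becomes the determinant of the two vectors of its ends, which vanishes if one of them is zero or
  their slopes agree.
\<close>

fun scaled_slope :: "(nat \<Rightarrow> 'k::field xypoly) \<Rightarrow> (nat \<Rightarrow> 'k xypoly) \<Rightarrow> indet \<Rightarrow> 'k xypoly" where
  "scaled_slope c \<tau> (X v) = c v"
| "scaled_slope c \<tau> (Y v) = c v * \<tau> v"

lemma subst_edge_binomial: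
  "subst (scaled_slope c \<tau>) (edge_binomial i j) = c i * c j * (\<tau> j - \<tau> i)"
  by (simp add: edge_binomial_def subst_diff subst_mult algebra_simps)

lemma edge_binomial_in_carrier:
  "i \<in> {1..N} \<Longrightarrow> j \<in> {1..N} \<Longrightarrow> edge_binomial i j \<in> poly_carrier N"
  by (simp add: edge_binomial_def poly_carrier_closed xvar_in_xy_ring yvar_in_xy_ring)

lemma binomial_edge_ideal_alt:
  "binomial_edge_ideal S G = Idl\<^bsub>S\<^esub> {edge_binomial i j | i j. {i, j} \<in> edges G}"
  by (simp add: binomial_edge_ideal_def edge_binomial_def)

lemma binomial_edge_ideal_xy_ring:
  assumes "\<And>i j. {i, j} \<in> edges G \<Longrightarrow> i \<in> {1..N}"
  shows "ideal (binomial_edge_ideal (xy_ring N) G) (xy_ring N)"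
    and "{i, j} \<in> edges G \<Longrightarrow> edge_binomial i j \<in> binomial_edge_ideal (xy_ring N) G"
    and "ideal I (xy_ring N) \<Longrightarrow> (\<And>i j. {i, j} \<in> edges G \<Longrightarrow> edge_binomial i j \<in> I) \<Longrightarrow>
      binomial_edge_ideal (xy_ring N) G \<subseteq> I"
proof -
  have "j \<in> {1..N}" if "{i, j} \<in> edges G" for i j
    using assms[of j i] that by (simp add: insert_commute)
  then have car: "{edge_binomial i j | i j. {i, j} \<in> edges G} \<subseteq> poly_carrier N"
    using assms edge_binomial_in_carrier by blast
  show "ideal (binomial_edge_ideal (xy_ring N) G) (xy_ring N)"
    and "{i, j} \<in> edges G \<Longrightarrow> edge_binomial i j \<in> binomial_edge_ideal (xy_ring N) G"
    and "ideal I (xy_ring N) \<Longrightarrow> (\<And>i j. {i, j} \<in> edges G \<Longrightarrow> edge_binomial i j \<in> I) \<Longrightarrow>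
      binomial_edge_ideal (xy_ring N) G \<subseteq> I"
    unfolding binomial_edge_ideal_alt using genideal_xy_ring[OF car] by blast+
qed

lemma subst_binomial_edge_ideal:
  assumes "\<And>i j. {i, j} \<in> edges G \<Longrightarrow> i \<in> {1..N}"
    and "\<And>i j. {i, j} \<in> edges G \<Longrightarrow> c i * c j * (\<tau> j - \<tau> i) = 0"
    and "g \<in> binomial_edge_ideal (xy_ring N) G"
  shows "subst (scaled_slope c \<tau>) g = 0"
proof -
  have "edge_binomial i j \<in> poly_carrier N" if "{i, j} \<in> edges G" for i j
    using that assms(1)[of i j] assms(1)[of j i]
    by (auto simp: insert_commute intro!: edge_binomial_in_carrier)
  then have "binomial_edge_ideal (xy_ring N) G \<subseteq> {g \<in> poly_carrier N. subst (scaled_slope c \<tau>) g = 0}"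
    by (intro binomial_edge_ideal_xy_ring(3) assms(1) ideal_kernel_subst)
      (simp_all add: subst_edge_binomial assms(2))
  then show ?thesis
    using assms(3) by auto
qed

lemma crown_edge_iff:
  "{u, v} \<in> edges (crown_graph n) \<longleftrightarrow> u \<in> {1..2 * n} \<and> v \<in> {1..2 * n} \<and>
     (odd u \<and> even v \<and> v \<noteq> u + 1 \<or> odd v \<and> even u \<and> u \<noteq> v + 1)"
proof -
  have half: "(\<exists>i j. x = 2 * i - 1 \<and> y = 2 * j \<and> i \<in> {1..n} \<and> j \<in> {1..n} \<and> i \<noteq> j) \<longleftrightarrow>
      x \<in> {1..2 * n} \<and> y \<in> {1..2 * n} \<and> odd x \<and> even y \<and> y \<noteq> x + 1" (is "?l = ?r") for x y
  proof
    assume ?l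
    then show ?r
      by auto
  next
    assume r: ?r
    then obtain i j where "x = 2 * i + 1" "y = 2 * j"
      by (auto elim!: oddE evenE)
    then show ?l
      using r by (intro exI[of _ "i + 1"] exI[of _ j]) auto
  qed
  have "{u, v} \<in> edges (crown_graph n) \<longleftrightarrow>
      (\<exists>i j. u = 2 * i - 1 \<and> v = 2 * j \<and> i \<in> {1..n} \<and> j \<in> {1..n} \<and> i \<noteq> j) \<or>
      (\<exists>i j. v = 2 * i - 1 \<and> u = 2 * j \<and> i \<in> {1..n} \<and> j \<in> {1..n} \<and> i \<noteq> j)"
    by (auto simp: crown_graph_def doubleton_eq_iff)
  then show ?thesis
    unfolding half by auto
qed

section \<open>The two surviving edges and their parametrizations\<close>

locale crown_pair =
  fixes n a b :: nat
  assumes odd: "odd a" "odd b" and neq: "a \<noteq> b" and bounds: "a < 2 * n" "b < 2 * n" "3 \<le> n"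
begin

text \<open>
  These are the vertices outside \<open>T\<close> when \<open>A\<close> consists of all odd vertices but \<open>a\<close> and \<open>b\<close>.
\<close>

definition survivors :: "nat set" where
  "survivors = {a, b, a + 1, b + 1}"

text \<open>
  The components of the graph on the survivors are \<open>{a, b + 1}\<close> and \<open>{b, a + 1}\<close>; each is
  labelled by its odd vertex.
\<close>

definition component :: "nat \<Rightarrow> nat" where
  "component v = (if v = a \<or> v = b + 1 then a else b)"

abbreviation J :: "'k::field xypoly set" where
  "J \<equiv> binomial_edge_ideal (xy_ring (2 * n)) (crown_graph n)"

definition prime_param :: "indet \<Rightarrow> 'k::field xypoly" where
  "prime_param = scaled_slope (\<lambda>v. if v \<in> survivors then xvar v else 0) (\<lambda>v. yvar (component v))"

text \<open>
  Vertices of the same parity as \<open>r\<close> go to \<open>0\<close>, except the other survivor \<open>r'\<close> of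
  that parity. The deleted vertices of opposite parity are all adjacent to \<open>r'\<close> and to no other
  vertex that is still nonzero; therefore they may be placed at any vector parallel to that of \<open>r'\<close>.
  Its slope is the component different from that of \<open>r\<close>. Scaling them by \<open>xvar r\<close>, a variable
  which \<open>r\<close> itself has freed, makes them nonzero, and yet \<open>0\<close> modulo \<open>xvar r\<close> as in
  \<open>prime_param\<close>.
\<close>

definition degenerate_param :: "nat \<Rightarrow> indet \<Rightarrow> 'k::field xypoly" where
  "degenerate_param r = scaled_slope
     (\<lambda>v. if v \<in> survivors then if v = r then 0 else xvar v
          else if odd v = odd r then 0 else xvar r)
     (\<lambda>v. yvar (if v \<in> survivors then component v else if component r = a then b else a))"

lemma twins_distinct: "a \<noteq> b + 1" "b \<noteq> a + 1" "a + 1 \<noteq> b" "b + 1 \<noteq> a"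
  using odd by auto

lemma finite_survivors: "finite survivors"
  by (simp add: survivors_def)

lemma survivors_range: "v \<in> survivors \<Longrightarrow> v \<in> {1..2 * n}"
  using bounds odd_pos[OF odd(1)] odd_pos[OF odd(2)] by (auto simp: survivors_def)

lemma sum_survivors: "(\<Sum>v\<in>survivors. h v) = h a + (h b + (h (a + 1) + h (b + 1)))"
  for h :: "nat \<Rightarrow> 'a::comm_monoid_add"
  using neq twins_distinct by (simp add: survivors_def)

lemma prod_survivors: "(\<Prod>v\<in>survivors. h v) = h a * (h b * (h (a + 1) * h (b + 1)))"
  for h :: "nat \<Rightarrow> 'a::comm_monoid_mult"
  using neq twins_distinct by (simp add: survivors_def)

lemma crown_vertex: "{i, j} \<in> edges (crown_graph n) \<Longrightarrow> i \<in> {1..2 * n}"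
  by (simp add: crown_edge_iff)

lemma J_ideal: "ideal J (xy_ring (2 * n))"
  by (rule binomial_edge_ideal_xy_ring(1)) (rule crown_vertex)

lemma edge_binomial_in_J: "{i, j} \<in> edges (crown_graph n) \<Longrightarrow> edge_binomial i j \<in> J"
  by (rule binomial_edge_ideal_xy_ring(2)) (rule crown_vertex)

lemma survivor_edge_iff:
  "u \<in> survivors \<Longrightarrow> v \<in> survivors \<Longrightarrow>
    {u, v} \<in> edges (crown_graph n) \<longleftrightarrow> u \<noteq> v \<and> component u = component v"
  unfolding crown_edge_iff using survivors_range[of u] survivors_range[of v] odd neq twins_distinct
  by (simp add: survivors_def component_def) (elim disjE; simp)

lemma subst_prime_param_edge_ideal: "g \<in> J \<Longrightarrow> subst prime_param g = 0"
  unfolding prime_param_def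
  by (erule subst_binomial_edge_ideal[rotated 2], erule crown_vertex) (auto simp: survivor_edge_iff)

lemma subst_degenerate_param_edge_ideal: 
  assumes "r \<in> survivors" "g \<in> J"
  shows "subst (degenerate_param r) g = 0"
  unfolding degenerate_param_def
proof (rule subst_binomial_edge_ideal[OF _ _ assms(2)], goal_cases)
  case (1 i j)
  then show ?case
    by (rule crown_vertex)
next
  case (2 i j)
  then show ?case
    using assms(1) odd neq twins_distinct
    by (cases "i \<in> survivors"; cases "j \<in> survivors")
      (simp_all add: survivor_edge_iff, auto simp: crown_edge_iff survivors_def component_def)
qed

lemma xvar_dvd_prime_param_minus_degenerate_param:
  assumes "r \<in> survivors"
  shows "xvar r dvd subst prime_param f - subst (degenerate_param r) f"
proof (rule dvd_subst_diff)
  fix u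
  show "xvar r dvd prime_param u - degenerate_param r u"
    using assms by (cases u) (auto simp: prime_param_def degenerate_param_def)
qed

text \<open>
  This is where \<open>n \<ge> 3\<close> enters: at least one twin pair is deleted.
\<close>

lemma ex_deleted_of_opposite_parity:
  obtains v where "v \<in> {1..2 * n} - survivors" "odd v \<noteq> odd r"
proof -
  have "\<exists>k \<in> {1, 3, 5 :: nat}. k \<noteq> a \<and> k \<noteq> b"
    unfolding bex_simps by presburger
  then obtain k where k: "k \<in> {1, 3, 5 :: nat}" "k \<noteq> a" "k \<noteq> b"
    by blast
  show ?thesis
  proof (rule that[of "if odd r then k + 1 else k"])
    show "(if odd r then k + 1 else k) \<in> {1..2 * n} - survivors"
      using k bounds odd by (auto simp: survivors_def)
  qed (use k in auto)
qed

section \<open>The ideal of the cut set as a kernel\<close>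

text \<open>
  The images of the monomials on the survivors record, for each survivor \<open>v\<close>, the degree in
  \<open>{x\<^sub>v, y\<^sub>v}\<close>, and for each component the total degree in its \<open>y\<close>-variables. These are
  exactly the data that determine a monomial modulo the two surviving binomials, by
  \<open>monomial_exchange\<close>.
\<close>

lemma kernel_prime_param_subset_ideal:
  assumes I: "ideal I (xy_ring (2 * n))"
    and vars: "\<And>v. v \<in> {1..2 * n} - survivors \<Longrightarrow> xvar v \<in> I \<and> yvar v \<in> I"
    and bin: "edge_binomial a (b + 1) \<in> I" "edge_binomial b (a + 1) \<in> I"
    and g: "g \<in> poly_carrier (2 * n)" "subst prime_param g = 0"
  shows "g \<in> I"
proof (rule kernel_subst_subset_if_fibres[where \<phi> = prime_param and
      M = "{m. Poly_Mapping.keys m \<subseteq> indets (2 * n)}" and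
      good = "\<lambda>m. Poly_Mapping.keys m \<subseteq> X ` survivors \<union> Y ` survivors" and
      \<epsilon> = "\<lambda>m. \<Sum>v\<in>survivors.
        Poly_Mapping.single (X v) (Poly_Mapping.lookup m (X v) + Poly_Mapping.lookup m (Y v)) +
        Poly_Mapping.single (Y (component v)) (Poly_Mapping.lookup m (Y v))"], goal_cases)
  case (3 m c)
  then obtain u where u: "u \<in> Poly_Mapping.keys m" "u \<in> indets (2 * n)" "u \<notin> X ` survivors \<union> Y ` survivors"
    by auto
  define v where "v = (case u of X i \<Rightarrow> i | Y i \<Rightarrow> i)"
  have v: "v \<in> {1..2 * n} - survivors" and uv: "u = X v \<or> u = Y v"
    using u by (auto simp: v_def indets_def)
  then have "prime_param u = 0"
    by (auto simp: prime_param_def)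
  then have "mono_val prime_param m = 0"
    using u(1) unfolding mono_val_def by (intro prod_zero) (auto simp: in_keys_iff)
  moreover have "Poly_Mapping.single m c \<in> I"
  proof -
    define m' where "m' = m - Poly_Mapping.single u 1"
    have "m = m' + Poly_Mapping.single u 1"
      using u(1) by (intro poly_mapping_eqI)
        (auto simp: m'_def lookup_add lookup_minus lookup_single when_def in_keys_iff)
    then have "Poly_Mapping.single m c = Poly_Mapping.single m' c * Poly_Mapping.single (Poly_Mapping.single u 1) 1"
      by (simp add: mult_single)
    moreover have "Poly_Mapping.single (Poly_Mapping.single u 1) 1 \<in> I"
      using vars[OF v] uv by (auto simp: xvar_def yvar_def)
    moreover have "Poly_Mapping.keys m' \<subseteq> Poly_Mapping.keys m"
      by (auto simp: m'_def lookup_minus in_keys_iff)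
    then have "Poly_Mapping.single m' c \<in> poly_carrier (2 * n)"
      using 3 by (auto simp: xy_ring_def)
    ultimately show ?thesis
      using ideal_closed(4)[OF I] by metis
  qed
  ultimately show ?case
    by simp
next
  case (4 m)
  have "mono_val prime_param m = (\<Prod>v\<in>survivors.
      xvar v ^ (Poly_Mapping.lookup m (X v) + Poly_Mapping.lookup m (Y v)) *
      yvar (component v) ^ Poly_Mapping.lookup m (Y v))"
    unfolding mono_val_over_vertices[OF finite_survivors 4(2)]
    by (rule prod.cong) (simp_all add: prime_param_def power_add power_mult_distrib mult_ac)
  then show ?case
    by (simp only: prod_var_powers)
next
  case (5 m m' c)
  define p where "p v = Poly_Mapping.lookup m (X v)" for v
  define q where "q v = Poly_Mapping.lookup m (Y v)" for v
  define p' where "p' v = Poly_Mapping.lookup m' (X v)" for v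
  define q' where "q' v = Poly_Mapping.lookup m' (Y v)" for v
  have eq: "Poly_Mapping.lookup (\<Sum>v\<in>survivors.
        Poly_Mapping.single (X v) (p v + q v) + Poly_Mapping.single (Y (component v)) (q v)) u =
      Poly_Mapping.lookup (\<Sum>v\<in>survivors.
        Poly_Mapping.single (X v) (p' v + q' v) + Poly_Mapping.single (Y (component v)) (q' v)) u" for u
    using 5(5) by (simp add: p_def q_def p'_def q'_def)
  note sums = eq[unfolded sum_survivors lookup_add lookup_single]
  have X: "p v + q v = p' v + q' v" if "v \<in> survivors" for v
    using sums[of "X v"] that neq twins_distinct by (auto simp: survivors_def)
  have Ya: "q a + q (b + 1) = q' a + q' (b + 1)"
    using sums[of "Y a"] neq twins_distinct by (simp add: component_def)
  have Yb: "q b + q (a + 1) = q' b + q' (a + 1)"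
    using sums[of "Y b"] neq twins_distinct by (simp add: component_def)
  have car: "xvar v \<in> poly_carrier (2 * n)" "yvar v \<in> poly_carrier (2 * n)" if "v \<in> survivors" for v
    using survivors_range[OF that] xvar_in_xy_ring yvar_in_xy_ring by blast+
  note [simp] = survivors_def
  let ?P = "\<lambda>p q u v. (xvar u ^ p u * yvar u ^ q u) * (xvar v ^ p v * yvar v ^ q v)"
  have 1: "?P p q a (b + 1) - ?P p' q' a (b + 1) \<in> I"
    by (rule monomial_exchange[OF I bin(1)[unfolded edge_binomial_def]]) (use Ya in \<open>simp_all add: car X\<close>)
  have 2: "?P p q b (a + 1) - ?P p' q' b (a + 1) \<in> I"
    by (rule monomial_exchange[OF I bin(2)[unfolded edge_binomial_def]]) (use Yb in \<open>simp_all add: car X\<close>)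
  have "?P p q a (b + 1) * ?P p q b (a + 1) - ?P p' q' a (b + 1) * ?P p' q' b (a + 1) \<in> I"
    by (rule ideal_mult_diff[OF I 1 2]) (simp_all add: car poly_carrier_closed)
  then have "Poly_Mapping.single 0 c *
      (?P p q a (b + 1) * ?P p q b (a + 1) - ?P p' q' a (b + 1) * ?P p' q' b (a + 1)) \<in> I"
    by (rule ideal_closed(4)[OF I, rotated]) (simp add: xy_ring_def)
  moreover have "Poly_Mapping.single m c = Poly_Mapping.single 0 c * (?P p q a (b + 1) * ?P p q b (a + 1))"
    using single_over_vertices[OF finite_survivors 5(3), of c]
    unfolding prod_survivors p_def q_def by (simp only: mult_ac)
  moreover have "Poly_Mapping.single m' c = Poly_Mapping.single 0 c * (?P p' q' a (b + 1) * ?P p' q' b (a + 1))"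
    using single_over_vertices[OF finite_survivors 5(4), of c]
    unfolding prod_survivors p'_def q'_def by (simp only: mult_ac)
  ultimately show ?case
    by (simp only: right_diff_distrib)
next
  case 6
  show ?case
    using g(1) by (auto simp: xy_ring_def)
qed (fact ideal_closed(2,3)[OF I] g(2))+

lemma components:
  "connected_components (induced_subgraph (crown_graph n) survivors) =
     {{a, b + 1}, {b, a + 1}}"
proof -
  let ?G = "induced_subgraph (crown_graph n) survivors"
  let ?E = "{(u, v). {u, v} \<in> edges ?G}"
  have verts: "verts ?G = survivors"
    using survivors_range by (auto simp: induced_subgraph_def crown_graph_def)
  have E: "(u, v) \<in> ?E \<longleftrightarrow> u \<in> survivors \<and> v \<in> survivors \<and> u \<noteq> v \<and> component u = component v" for u v
    using survivor_edge_iff[of u v] by (auto simp: induced_subgraph_def)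
  have "(u, v) \<in> ?E\<^sup>* \<longleftrightarrow> component u = component v" if "u \<in> survivors" "v \<in> survivors" for u v
  proof
    assume "(u, v) \<in> ?E\<^sup>*"
    then show "component u = component v"
      by (induction rule: rtrancl_induct) (use E in auto)
  next
    assume "component u = component v"
    then show "(u, v) \<in> ?E\<^sup>*"
      using E[of u v] that by (cases "u = v") auto
  qed
  then have "connected_components ?G =
      survivors // {(u, v). u \<in> survivors \<and> v \<in> survivors \<and> component u = component v}"
    unfolding connected_components_def verts by (intro arg_cong[where f = "(//) survivors"]) auto
  also have "\<dots> = (\<lambda>u. {v \<in> survivors. component u = component v}) ` survivors"
    by (auto simp: quotient_def)
  also have "\<dots> = {{a, b + 1}, {b, a + 1}}"
  proof -
    have "{v \<in> survivors. component u = component v} = (if component u = a then {a, b + 1} else {b, a + 1})" for u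
      using neq twins_distinct by (auto simp: survivors_def component_def)
    then show ?thesis
      using neq twins_distinct by (auto simp: survivors_def component_def)
  qed
  finally show ?thesis .
qed

lemma P_ideal_eq_kernel:
  "P_ideal (xy_ring (2 * n)) (crown_graph n) ({1..2 * n} - survivors) =
     {g \<in> poly_carrier (2 * n). subst prime_param g = 0}"
  (is "P_ideal ?S ?G ?T = ?K")
proof -
  have W: "W \<subseteq> survivors \<and> (\<forall>i\<in>W. \<forall>j\<in>W. component i = component j)" if "W \<in> {{a, b + 1}, {b, a + 1}}" for W
    using that neq twins_distinct by (auto simp: survivors_def component_def)
  have edge: "i \<in> W \<and> j \<in> W" if "{i, j} \<in> edges (complete_graph W)" for i j W
    using that by (auto simp: complete_graph_def doubleton_eq_iff)
  have range: "i \<in> {1..2 * n}" if "{i, j} \<in> edges (complete_graph W)" "W \<in> {{a, b + 1}, {b, a + 1}}" for i j W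
    using edge[OF that(1)] W[OF that(2)] survivors_range[of i] by blast
  define V :: "'a xypoly set" where "V = xvar ` ?T \<union> yvar ` ?T"
  define B :: "'a xypoly set" where
    "B = (\<Union>W\<in>{{a, b + 1}, {b, a + 1}}. binomial_edge_ideal ?S (complete_graph W))"
  have comps: "connected_components (induced_subgraph ?G (verts ?G - ?T)) = {{a, b + 1}, {b, a + 1}}"
    using components survivors_range
    by (auto simp: crown_graph_def double_diff subset_iff intro!: arg_cong2[where f = induced_subgraph])
  have P: "P_ideal ?S ?G ?T = Idl\<^bsub>?S\<^esub> (Idl\<^bsub>?S\<^esub> V \<union> B)"
    unfolding P_ideal_def comps V_def B_def ..
  have V: "V \<subseteq> ?K"
    by (auto simp: V_def prime_param_def intro!: xvar_in_xy_ring yvar_in_xy_ring)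
  then have VC: "V \<subseteq> poly_carrier (2 * n)"
    by blast
  have B: "B \<subseteq> ?K"
    unfolding B_def
  proof (rule UN_least)
    fix W assume Wc: "W \<in> {{a, b + 1}, {b, a + 1}}"
    show "binomial_edge_ideal ?S (complete_graph W) \<subseteq> ?K"
    proof (rule binomial_edge_ideal_xy_ring(3)[OF _ ideal_kernel_subst], goal_cases)
      case (1 i j)
      then show ?case using range Wc by blast
    next
      case (2 i j)
      have ij: "i \<in> survivors" "j \<in> survivors" "component i = component j"
        using edge[OF 2] W[OF Wc] by auto
      then have "edge_binomial i j \<in> poly_carrier (2 * n)"
        by (intro edge_binomial_in_carrier survivors_range)
      then show ?case
        using ij by (simp add: prime_param_def subst_edge_binomial)
    qed
  qed
  have VK: "Idl\<^bsub>?S\<^esub> V \<subseteq> ?K"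
    by (rule genideal_xy_ring(3)[OF VC ideal_kernel_subst V])
  have car: "Idl\<^bsub>?S\<^esub> V \<union> B \<subseteq> poly_carrier (2 * n)"
    using VK B by blast
  have "P_ideal ?S ?G ?T \<subseteq> ?K"
    unfolding P by (rule genideal_xy_ring(3)[OF car ideal_kernel_subst]) (use VK B in blast)
  moreover have "?K \<subseteq> P_ideal ?S ?G ?T"
  proof
    fix g :: "'a xypoly" assume g: "g \<in> ?K"
    have gen: "Idl\<^bsub>?S\<^esub> V \<union> B \<subseteq> P_ideal ?S ?G ?T"
      unfolding P by (rule genideal_xy_ring(2)[OF car])
    have bin: "edge_binomial i j \<in> B" if "W \<in> {{a, b + 1}, {b, a + 1}}" "i \<in> W" "j \<in> W" "i \<noteq> j" for i j W
    proof -
      have "edge_binomial i j \<in> binomial_edge_ideal ?S (complete_graph W)"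
        by (rule binomial_edge_ideal_xy_ring(2)) (use that range in \<open>auto simp: complete_graph_def\<close>)
      then show ?thesis
        using that(1) unfolding B_def by blast
    qed
    show "g \<in> P_ideal ?S ?G ?T"
    proof (rule kernel_prime_param_subset_ideal)
      show "ideal (P_ideal ?S ?G ?T) ?S"
        unfolding P by (rule genideal_xy_ring(1)[OF car])
      show "xvar v \<in> P_ideal ?S ?G ?T \<and> yvar v \<in> P_ideal ?S ?G ?T" if "v \<in> ?T" for v
      proof -
        have "xvar v \<in> V" "yvar v \<in> V"
          using that by (simp_all add: V_def)
        then show ?thesis
          using gen genideal_xy_ring(2)[OF VC] by blast
      qed
      show "edge_binomial a (b + 1) \<in> P_ideal ?S ?G ?T"
        using bin[of "{a, b + 1}" a "b + 1"] gen twins_distinct by auto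
      show "edge_binomial b (a + 1) \<in> P_ideal ?S ?G ?T"
        using bin[of "{b, a + 1}" b "a + 1"] gen twins_distinct by auto
    qed (use g in auto)
  qed
  ultimately show ?thesis
    by blast
qed

section \<open>A witness of degree four\<close>

definition witness :: "'k::field xypoly" where
  "witness = edge_binomial a b * edge_binomial (a + 1) (b + 1)"

lemma witness_in_carrier: "witness \<in> poly_carrier (2 * n)"
  unfolding witness_def
  by (intro poly_carrier_closed edge_binomial_in_carrier survivors_range) (simp_all add: survivors_def)

lemma witness_in_hom_component: "witness \<in> hom_component (xy_ring (2 * n)) 4"
proof -
  have bin: "weighted_hom mono_degree 2 (edge_binomial i j :: 'k::field xypoly)" for i j
    unfolding edge_binomial_def one_add_one[symmetric]
    by (intro weighted_hom_diff weighted_hom_mult weight_mono_degree weighted_hom_xvar weighted_hom_yvar)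
  have "weighted_hom mono_degree (2 + 2) (witness :: 'a xypoly)"
    unfolding witness_def by (rule weighted_hom_mult[OF weight_mono_degree bin bin])
  then show ?thesis
    using witness_in_carrier by (simp add: hom_component_def weighted_hom_def)
qed

lemma subst_prime_param_witness: "subst prime_param witness \<noteq> 0"
proof -
  have y: "yvar a - yvar b \<noteq> (0 :: 'k::field xypoly)"
  proof -
    have "Poly_Mapping.lookup (yvar a - yvar b :: 'k xypoly) (Poly_Mapping.single (Y a) 1) = 1"
      using neq by (auto simp: yvar_def lookup_minus lookup_single when_def dest!: arg_cong[where f = Poly_Mapping.keys])
    then show ?thesis
      by auto
  qed
  then have "yvar b - yvar a \<noteq> (0 :: 'k::field xypoly)"
    by (metis right_minus_eq)
  then show ?thesis
    using y neq twins_distinct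
    by (simp add: xvar_nonzero witness_def prime_param_def subst_mult subst_edge_binomial survivors_def component_def)
qed

text \<open>
  These are Pluecker relations: the vector of \<open>z\<close> times the determinant of those of \<open>c\<close> and \<open>d\<close> is a
  combination of the determinants of \<open>z\<close> with \<open>c\<close> and with \<open>d\<close>.
\<close>

lemma cross_edge_binomials:
  assumes J: "ideal I (xy_ring N)" "z \<in> {1..N}" "c \<in> {1..N}" "d \<in> {1..N}"
    and e: "edge_binomial z c \<in> I" "edge_binomial z d \<in> I"
  shows "xvar z * edge_binomial c d \<in> I" "yvar z * edge_binomial c d \<in> I"
proof -
  have *: "xvar v * p - xvar w * q \<in> I" "yvar v * p - yvar w * q \<in> I"
    if "v \<in> {1..N}" "w \<in> {1..N}" "p \<in> I" "q \<in> I" for v w p q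
    by (intro ideal_closed(4,5)[OF J(1)] xvar_in_xy_ring yvar_in_xy_ring that)+
  have eqs: "xvar z * edge_binomial c d = xvar c * edge_binomial z d - xvar d * edge_binomial z c"
    "yvar z * edge_binomial c d = yvar c * edge_binomial z d - yvar d * edge_binomial z c"
    by (simp_all add: edge_binomial_def algebra_simps)
  show "xvar z * edge_binomial c d \<in> I" "yvar z * edge_binomial c d \<in> I"
    unfolding eqs by (rule *[OF J(3,4) e(2,1)])+
qed

text \<open>
  It suffices to multiply generators of the kernel by the witness. The surviving binomials are edges
  of the crown graph. An odd deleted vertex is adjacent to \<open>a + 1\<close> and \<open>b + 1\<close>, an even one to \<open>a\<close> and
  \<open>b\<close>, so one factor of the witness carries its variables into the edge ideal.
\<close>

lemma kernel_times_witness: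
  fixes g :: "'k::field xypoly"
  assumes "g \<in> poly_carrier (2 * n)" "subst prime_param g = 0"
  shows "g * witness \<in> J"
proof -
  have car: "edge_binomial u v \<in> (poly_carrier (2 * n) :: 'k xypoly set)"
    if "u \<in> survivors" "v \<in> survivors" for u v
    using that by (intro edge_binomial_in_carrier survivors_range)
  note [simp] = survivors_def
  have "g \<in> colon_ideal (xy_ring (2 * n)) J witness"
  proof (rule kernel_prime_param_subset_ideal[OF ideal_colon[OF J_ideal] _ _ _ assms], goal_cases)
    case (1 v)
    (* c and d are the survivors of the parity opposite to v; s is the other factor of the witness. *)
    define c d where "c = (if odd v then a + 1 else a)" and "d = (if odd v then b + 1 else b)"
    define s :: "'k xypoly" where "s = (if odd v then edge_binomial a b else edge_binomial (a + 1) (b + 1))"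
    have ws: "witness = edge_binomial c d * s"
      by (simp add: witness_def c_def d_def s_def)
    have "s \<in> poly_carrier (2 * n)"
      by (simp add: s_def car)
    moreover have cd: "c \<in> {1..2 * n}" "d \<in> {1..2 * n}"
      using survivors_range[of c] survivors_range[of d] by (simp_all add: c_def d_def)
    moreover have "{v, c} \<in> edges (crown_graph n)" "{v, d} \<in> edges (crown_graph n)"
      using 1 cd odd by (auto simp: crown_edge_iff c_def d_def)
    then have "xvar v * edge_binomial c d \<in> (J :: 'k xypoly set)"
      "yvar v * edge_binomial c d \<in> (J :: 'k xypoly set)"
      using 1 cd by (auto intro!: cross_edge_binomials[OF J_ideal] edge_binomial_in_J)
    ultimately have "s * (xvar v * edge_binomial c d) \<in> J" "s * (yvar v * edge_binomial c d) \<in> J"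
      by (simp_all add: ideal_closed(4)[OF J_ideal])
    then show ?case
      using 1 xvar_in_xy_ring[of v "2 * n"] yvar_in_xy_ring[of v "2 * n"]
      by (simp add: colon_ideal_def ws mult_ac)
  next
    case 2
    have "edge_binomial a (b + 1) \<in> (J :: 'k xypoly set)"
      by (rule edge_binomial_in_J) (subst survivor_edge_iff; use twins_distinct in \<open>simp add: component_def\<close>)
    from ideal_closed(4)[OF J_ideal witness_in_carrier this] show ?case
      using car by (simp add: colon_ideal_def mult.commute[of witness])
  next
    case 3
    have "edge_binomial b (a + 1) \<in> (J :: 'k xypoly set)"
      by (rule edge_binomial_in_J) (subst survivor_edge_iff; use neq twins_distinct in \<open>simp add: component_def\<close>)
    from ideal_closed(4)[OF J_ideal witness_in_carrier this] show ?case
      using car by (simp add: colon_ideal_def mult.commute[of witness])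
  qed
  then show ?thesis
    by (simp add: colon_ideal_def)
qed

text \<open>
  Conversely, a multiplier of the witness into the edge ideal lies in the kernel, because the target
  of the substitution is an integral domain and the image of the witness is nonzero.
\<close>

lemma colon_witness:
  "colon_ideal (xy_ring (2 * n)) J witness = {g \<in> poly_carrier (2 * n). subst prime_param g = 0}"
proof -
  have "subst prime_param g = 0" if "g * witness \<in> J" for g :: "'k::field xypoly"
    using subst_prime_param_edge_ideal[OF that] subst_prime_param_witness[where ?'a = 'k] by (simp add: subst_mult)
  then show ?thesis
    using kernel_times_witness by (auto simp: colon_ideal_def)
qed

section \<open>The lower bound on the degree\<close>

text \<open>
  Every monomial of the image of \<open>f\<close> is divisible by each of the four variables \<open>xvar r\<close>, and has
  degree \<open>d\<close> in them.
\<close>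

lemma degree_ge_4_if_colon_eq_kernel:
  fixes f :: "'k::field xypoly"
  assumes f: "f \<in> hom_component (xy_ring (2 * n)) d"
    and colon: "colon_ideal (xy_ring (2 * n)) J f = {g \<in> poly_carrier (2 * n). subst prime_param g = 0}"
  shows "4 \<le> d"
proof -
  have fC: "f \<in> poly_carrier (2 * n)"
    using f by (simp add: hom_component_def)
  (* Otherwise f lies in its own colon ideal, hence annihilates the witness modulo J, and the
     witness would lie in the kernel. *)
  have "subst prime_param f \<noteq> 0"
  proof
    assume "subst prime_param f = 0"
    then have "witness * f \<in> J"
      using kernel_times_witness[OF fC] by (simp add: mult.commute)
    then have "subst prime_param (witness :: 'k xypoly) = 0"
      using colon witness_in_carrier by (auto simp: colon_ideal_def)
    then show False
      by (simp add: subst_prime_param_witness)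
  qed
  then obtain e where e: "e \<in> Poly_Mapping.keys (subst prime_param f)"
    by (metis ex_in_conv keys_eq_empty)
  have ge: "1 \<le> Poly_Mapping.lookup e (X r)" if r: "r \<in> survivors" for r
  proof -
    obtain v where v: "v \<in> {1..2 * n} - survivors" "odd v \<noteq> odd r"
      by (rule ex_deleted_of_opposite_parity)
    have "xvar v \<in> {g \<in> poly_carrier (2 * n). subst prime_param g = (0 :: 'k xypoly)}"
      using v xvar_in_xy_ring[of v "2 * n"] by (simp add: prime_param_def)
    then have "xvar v * f \<in> J"
      unfolding colon[symmetric] by (simp add: colon_ideal_def)
    then have "subst (degenerate_param r) (xvar v * f) = 0"
      by (rule subst_degenerate_param_edge_ideal[OF r])
    moreover have "degenerate_param r (X v) = (xvar r :: 'k xypoly)"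
      using v by (simp add: degenerate_param_def)
    ultimately have "subst (degenerate_param r) f = 0"
      by (simp add: subst_mult xvar_nonzero)
    then show ?thesis
      using xvar_dvd_prime_param_minus_degenerate_param[OF r, of f] lookup_ge_1_of_xvar_dvd[OF _ e] by simp
  qed
  (* The degree in the variables xvar r alone: the slopes contribute nothing, so the parametrization
     turns total degree into w. *)
  define w where "w e = (\<Sum>r\<in>survivors. Poly_Mapping.lookup e (X r))" for e :: mono
  have w: "weight w"
    by (simp add: weight_def w_def lookup_add sum.distrib)
  have wX: "weighted_hom w 1 (xvar v :: 'k xypoly)" if "v \<in> survivors" for v
    using that finite_survivors
    by (simp add: weighted_hom_def xvar_def w_def lookup_single when_def sum.delta)
  have wY: "weighted_hom w 0 (yvar v :: 'k xypoly)" for v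
    by (simp add: weighted_hom_def yvar_def w_def lookup_single)
  have "weighted_hom w 1 (prime_param u :: 'k xypoly)" for u
  proof (cases u)
    case (X v)
    then show ?thesis
      using wX[of v] by (auto simp: prime_param_def weighted_hom_def)
  next
    case (Y v)
    then show ?thesis
      using weighted_hom_mult[OF w wX[of v] wY[of "component v"]] by (auto simp: prime_param_def weighted_hom_def)
  qed
  then have "weighted_hom w d (subst prime_param f)"
    using f by (intro weighted_hom_subst w) (simp_all add: hom_component_def weighted_hom_def)
  then have "w e = d"
    using e by (simp add: weighted_hom_def)
  moreover have "(\<Sum>r\<in>survivors. 1) \<le> w e"
    unfolding w_def by (rule sum_mono) (rule ge)
  moreover have "(\<Sum>r\<in>survivors. 1) = (4 :: nat)"
    unfolding sum_survivors by simp
  ultimately show ?thesis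
    by simp
qed

lemma local_v_number_eq_4:
  "local_v_number (xy_ring (2 * n) :: 'k::field xypoly ring)
     (P_ideal (xy_ring (2 * n)) (crown_graph n) ({1..2 * n} - survivors)) J = 4"
proof -
  let ?D = "{d. \<exists>f \<in> hom_component (xy_ring (2 * n) :: 'k xypoly ring) d.
    colon_ideal (xy_ring (2 * n)) J f = {g \<in> poly_carrier (2 * n). subst prime_param g = 0}}"
  have "4 \<in> ?D"
    by (rule CollectI, rule bexI, rule colon_witness, rule witness_in_hom_component)
  then have "Inf (enat ` ?D) \<le> enat 4"
    by (intro Inf_lower imageI)
  moreover have "enat 4 \<le> Inf (enat ` ?D)"
    by (rule Inf_greatest) (auto intro: degree_ge_4_if_colon_eq_kernel)
  ultimately show ?thesis
    unfolding local_v_number_def P_ideal_eq_kernel by (simp add: numeral_eq_enat)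
qed

end

section \<open>The local v-number\<close>

theorem lemma5p7:
  fixes n :: nat and A T :: "nat set" and S :: "'k::field xypoly ring" and G :: graph
  assumes "S = xy_ring (2 * n)"
    and "n \<ge> 3"
    and "G = crown_graph n"
    and "A \<subseteq> {2 * i - 1 | i. i \<in> {1..n}}"
    and "card A = n - 2"
    and "T = A \<union> {i + 1 | i. i \<in> A}"
  shows "local_v_number S (P_ideal S G T) (binomial_edge_ideal S G) = 4"
proof -
  define Odds where "Odds = (\<lambda>i. 2 * i - 1) ` {1..n}"
  have A_Odds: "A \<subseteq> Odds"
    using assms(4) unfolding Odds_def image_def by blast
  have "card Odds = n"
    unfolding Odds_def by (subst card_image) (auto simp: inj_on_def)
  then have "card (Odds - A) = 2"
    using assms(2,5) A_Odds finite_subset[OF A_Odds] by (simp add: card_Diff_subset Odds_def)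
  then obtain a b where ab: "Odds - A = {a, b}" "a \<noteq> b"
    by (auto simp: card_2_iff)
  have Odds_iff: "v \<in> Odds \<longleftrightarrow> odd v \<and> v < 2 * n" for v
  proof
    assume "odd v \<and> v < 2 * n"
    then show "v \<in> Odds"
      unfolding Odds_def by (intro image_eqI[of _ _ "v div 2 + 1"]) (auto elim!: oddE)
  qed (auto simp: Odds_def)
  interpret crown_pair n a b
    using ab assms(2) Odds_iff[of a] Odds_iff[of b] by unfold_locales auto
  have A: "v \<in> A \<longleftrightarrow> odd v \<and> v < 2 * n \<and> v \<noteq> a \<and> v \<noteq> b" for v
    using ab A_Odds Odds_iff by blast
  have "T = {1..2 * n} - survivors"
  proof (rule Set.set_eqI)
    fix v
    have "v \<in> T \<longleftrightarrow> v \<in> A \<or> (v > 0 \<and> v - 1 \<in> A)"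
      unfolding assms(6) by force
    also have "\<dots> \<longleftrightarrow> v \<in> {1..2 * n} - survivors"
    proof -
      have "v \<noteq> 2 * n" if "odd v"
        using that by auto
      then show ?thesis
        using odd by (cases v) (auto simp: A survivors_def)
    qed
    finally show "v \<in> T \<longleftrightarrow> v \<in> {1..2 * n} - survivors" .
  qed
  then show ?thesis
    using local_v_number_eq_4 assms(1,3) by simp
qed

end
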